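(* Let $N\ge3$ be an integer, $K=\lceil\log_2(N-1)\rceil$, $\epsilon\in(0,1)$, and $\delta_\epsilon=(1+\epsilon)^{1/K}-1$, where $\delta_\epsilon<\frac14$. Consider the cone $L^N$ and its polyhedral outer-approximation $\bar Q^N(\hat\theta)$. Then the largest coefficient used in the description of the polyhedral cone $\bar Q^N(\hat\theta)$ is upper bounded by $$\frac{4\lceil\log_2(N-1)\rceil}{(\ln2)\,\epsilon}.$$
   Context: $L^N=\{x\in\mathbb{R}^N:\sqrt{x_1^2+\cdots+x_{N-1}^2}\le x_N\}$. For a positive integer $\nu$ and angles $\theta_j\in(0,\pi/2)$ with $\sin(\theta_j)=a_j/c_j$, $\cos(\theta_j)=b_j/c_j$ for positive coprime integers $a_j,b_j,c_j$, $j=1,\dots,\nu$, $\tilde P^\nu(\theta)$ is the set of $x\in\mathbb{R}^3$ for which there exist reals $\xi^j,\eta^j$, $j=0,\dots,\nu$, satisfying - $\xi^0\ge|x_1|$, $\eta^0\ge|x_2|$; - $c_j\xi^j=b_j\xi^{j-1}+a_j\eta^{j-1}$ for $j=1,\dots,\nu$; - $c_j\eta^j\ge|-a_j\xi^{j-1}+b_j\eta^{j-1}|$ for $j=1,\dots,\nu$; - $\xi^\nu\le x_3$ and $b_\nu\eta^\nu\le a_\nu\xi^\nu$. The angles $\hat\theta_j=\operatorname{arcsec}(\hat c_j/\hat b_j)$ are given by $(\hat a_1,\hat b_1,\hat c_1)=(120,119,169)$ and, for $j\ge2$, $(\hat a_j,\hat b_j,\hat c_j)=(2h_j-1,\,2h_j^2-2h_j,\,2h_j^2-2h_j+1)$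 with $h_j=2^{j-2}+2$. For $\delta\in(0,\frac14)$, $\hat\nu_\delta=\lceil\log_2(-6+2\sqrt{1+2/\delta})\rceil$. $\bar Q^N(\hat\theta)$ is the set of $x\in\mathbb{R}^N$ for which there exist reals $y_{k,i}$ ($k=0,\dots,K$, $i=1,\dots,2^{K-k}$) with $y_{0,i}=x_i$ for $i=1,\dots,N-1$, $y_{0,i}=0$ for $N\le i\le2^K$, $y_{K,1}=x_N$, and $(y_{k,2i-1},y_{k,2i},y_{k+1,i})\in\tilde P^{\hat\nu_{\delta_\epsilon}}(\hat\theta)$ for $k=0,\dots,K-1$, $i=1,\dots,2^{K-k-1}$. (So $\delta_\epsilon$ is the largest $\delta$ with $(1+\delta)^K\le1+\epsilon$.) Convention for "largest coefficient": the largest coefficient used in the description of $\tilde P^{\hat\nu_\delta}(\hat\theta)$ is defined to be $C_\delta:=2\hat h^2-2\hat h+1$ with $\hat h:=2^{\hat\nu_\delta-2}+2$; since the description of $\bar Q^N(\hat\theta)$ consists of copies of that of $\tilde P^{\hat\nu_{\delta_\epsilon}}(\hat\theta)$, its largest coefficient is $C_{\delta_\epsilon}$. *)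

theory Defs
  imports Complex_Main "HOL-Library.FuncSet"
begin

text \<open>Points of \<open>\<real>\<^sup>N\<close> are functions on \<open>{1..N}\<close>, extensional so that equality is coordinatewise.\<close>

definition Lorentz_cone :: "nat \<Rightarrow> (nat \<Rightarrow> real) set"
  where "Lorentz_cone N = {x \<in> {1..N} \<rightarrow>\<^sub>E UNIV. sqrt (\<Sum>i = 1..N - 1. (x i)\<^sup>2) \<le> x N}"

text \<open>The angles \<open>\<theta>\<^sub>j\<close> enter only through the integers in \<open>sin \<theta>\<^sub>j = a\<^sub>j / c\<^sub>j\<close> and
  \<open>cos \<theta>\<^sub>j = b\<^sub>j / c\<^sub>j\<close>, so the cone takes these as parameters.  It is meaningful for
  \<open>\<nu> \<ge> 1\<close> only.\<close>

definition P_tilde ::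
  "nat \<Rightarrow> (nat \<Rightarrow> int) \<Rightarrow> (nat \<Rightarrow> int) \<Rightarrow> (nat \<Rightarrow> int) \<Rightarrow> (real \<times> real \<times> real) set"
  where "P_tilde \<nu> a b c =
    {(x1, x2, x3). \<exists>\<xi> \<eta> :: nat \<Rightarrow> real.
       \<xi> 0 \<ge> \<bar>x1\<bar> \<and> \<eta> 0 \<ge> \<bar>x2\<bar> \<and>
       (\<forall>j\<in>{1..\<nu>}. c j * \<xi> j = b j * \<xi> (j - 1) + a j * \<eta> (j - 1)) \<and>
       (\<forall>j\<in>{1..\<nu>}. c j * \<eta> j \<ge> \<bar>- a j * \<xi> (j - 1) + b j * \<eta> (j - 1)\<bar>) \<and>
       \<xi> \<nu> \<le> x3 \<and> b \<nu> * \<eta> \<nu> \<le> a \<nu> * \<xi> \<nu>}"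

text \<open>In the next four definitions only the values at \<open>j \<ge> 1\<close> (for \<open>h_seq\<close>, \<open>j \<ge> 2\<close>) matter.\<close>

definition h_seq :: "nat \<Rightarrow> int"
  where "h_seq j = 2 ^ (j - 2) + 2"

definition a_hat :: "nat \<Rightarrow> int"
  where "a_hat j = (if j = 1 then 120 else 2 * h_seq j - 1)"

definition b_hat :: "nat \<Rightarrow> int"
  where "b_hat j = (if j = 1 then 119 else 2 * (h_seq j)\<^sup>2 - 2 * h_seq j)"

definition c_hat :: "nat \<Rightarrow> int"
  where "c_hat j = (if j = 1 then 169 else 2 * (h_seq j)\<^sup>2 - 2 * h_seq j + 1)"

text \<open>\<open>arcsec t = arccos (1 / t)\<close>\<close>

definition theta_hat :: "nat \<Rightarrow> real"
  where "theta_hat j = arccos (b_hat j / c_hat j)"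

lemma abc_hat_pos: "a_hat j > 0" "b_hat j > 0" "c_hat j > 0"
proof -
  have h: "h_seq j \<ge> 3" by (simp add: h_seq_def)
  then have "h_seq j * h_seq j \<ge> 3 * h_seq j" by (intro mult_right_mono) auto
  with h have "(h_seq j)\<^sup>2 > h_seq j" by (simp add: power2_eq_square)
  with h show "a_hat j > 0" "b_hat j > 0" "c_hat j > 0"
    by (auto simp: a_hat_def b_hat_def c_hat_def)
qed

lemma abc_hat_pythagoras: "(a_hat j)\<^sup>2 + (b_hat j)\<^sup>2 = (c_hat j)\<^sup>2"
  by (auto simp: a_hat_def b_hat_def c_hat_def power2_eq_square algebra_simps)

lemma cos_theta_hat: "cos (theta_hat j) = b_hat j / c_hat j"
  and sin_theta_hat: "sin (theta_hat j) = a_hat j / c_hat j"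
proof -
  have sq: "(real_of_int (a_hat j))\<^sup>2 + (real_of_int (b_hat j))\<^sup>2 = (real_of_int (c_hat j))\<^sup>2"
    by (metis abc_hat_pythagoras of_int_add of_int_power)
  have pos: "real_of_int (a_hat j) > 0" "real_of_int (b_hat j) > 0" "real_of_int (c_hat j) > 0"
    using abc_hat_pos[of j] by auto
  have "b_hat j \<le> c_hat j"
    by (simp add: b_hat_def c_hat_def)
  then have bc: "real_of_int (b_hat j) \<le> real_of_int (c_hat j)"
    by simp
  have range: "- 1 \<le> b_hat j / c_hat j" "b_hat j / c_hat j \<le> 1"
    using pos bc by (auto simp: field_simps)
  then show "cos (theta_hat j) = b_hat j / c_hat j"
    by (simp add: theta_hat_def)
  have "1 - (b_hat j / c_hat j)\<^sup>2 = (a_hat j / c_hat j)\<^sup>2"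
    using sq pos by (simp add: power_divide field_simps)
  moreover have "(a_hat j / c_hat j) \<ge> 0"
    using pos by simp
  ultimately show "sin (theta_hat j) = a_hat j / c_hat j"
    using range pos by (simp add: theta_hat_def sin_arccos)
qed

lemma theta_hat_range: "0 < theta_hat j" "theta_hat j < pi / 2"
proof -
  have pos: "real_of_int (b_hat j) > 0" "real_of_int (c_hat j) > 0"
    using abc_hat_pos[of j] by auto
  have "b_hat j < c_hat j"
    by (simp add: b_hat_def c_hat_def)
  then have "0 < b_hat j / c_hat j" "b_hat j / c_hat j < 1"
    using pos by (simp_all add: field_simps)
  then have "arccos 1 < theta_hat j" "theta_hat j < arccos 0"
    unfolding theta_hat_def by (intro arccos_less_arccos; simp)+
  then show "0 < theta_hat j" "theta_hat j < pi / 2"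
    by simp_all
qed

lemma coprime_b_c_hat: "coprime (b_hat j) (c_hat j)"
proof (cases "j = 1")
  case True
  have "coprime (119 :: int) 169"
  proof (rule coprimeI)
    fix d :: int
    assume "d dvd 119" "d dvd 169"
    then have "d dvd 50 * 169 - 71 * 119"
      by (intro dvd_diff dvd_mult)
    then show "is_unit d"
      by simp
  qed
  then show ?thesis
    using True by (simp add: b_hat_def c_hat_def)
next
  case False
  then have "c_hat j = b_hat j + 1"
    by (simp add: b_hat_def c_hat_def)
  then show ?thesis
    by simp
qed

text \<open>An integer that need not be positive: the argument of the logarithm tends to \<open>0\<close> as
  \<open>\<delta>\<close> tends to \<open>1/4\<close>.  The exponent \<open>\<nu> - 2\<close> below is therefore an integer exponent on a real base.\<close>

definition nu_hat :: "real \<Rightarrow> int"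
  where "nu_hat \<delta> = \<lceil>log 2 (- 6 + 2 * sqrt (1 + 2 / \<delta>))\<rceil>"

text \<open>By convention, the largest coefficient in the description of \<open>P_tilde\<close> for
  \<open>nu_hat \<delta>\<close> and the angles \<open>theta_hat\<close> is the formula for \<open>c_hat\<close> at \<open>nu_hat \<delta>\<close>; the constants
  \<open>120, 119, 169\<close> of the first angle are disregarded.\<close>

definition largest_coeff_P :: "real \<Rightarrow> real"
  where "largest_coeff_P \<delta> =
    (let h = 2 powi (nu_hat \<delta> - 2) + 2 in 2 * h\<^sup>2 - 2 * h + 1)"

definition K_of :: "nat \<Rightarrow> nat"
  where "K_of N = nat \<lceil>log 2 (real N - 1)\<rceil>"

definition delta_of :: "nat \<Rightarrow> real \<Rightarrow> real"
  where "delta_of N \<epsilon> = (1 + \<epsilon>) powr (1 / real (K_of N)) - 1"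

text \<open>\<open>Copy \<delta> k i\<close> is the copy of the description of \<open>P_tilde\<close> for \<open>nu_hat \<delta>\<close> and
  \<open>theta_hat\<close> imposed on the variables at position \<open>i\<close> between the levels \<open>k\<close> and \<open>k + 1\<close>.
  Coefficients belong to a description rather than to the set it describes, so the
  description of \<open>Q_bar\<close> is a separate object.\<close>

datatype P_copy = Copy (copy_delta: real) nat nat

fun satisfies :: "(nat \<Rightarrow> nat \<Rightarrow> real) \<Rightarrow> P_copy \<Rightarrow> bool"
  where "satisfies y (Copy \<delta> k i) \<longleftrightarrow>
    (y k (2 * i - 1), y k (2 * i), y (k + 1) i) \<in> P_tilde (nat (nu_hat \<delta>)) a_hat b_hat c_hat"

definition Q_bar_description :: "nat \<Rightarrow> real \<Rightarrow> P_copy set"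
  where "Q_bar_description N \<epsilon> =
    (\<lambda>(k, i). Copy (delta_of N \<epsilon>) k i) ` (SIGMA k : {..<K_of N}. {1..2 ^ (K_of N - k - 1)})"

definition Q_bar :: "nat \<Rightarrow> real \<Rightarrow> (nat \<Rightarrow> real) set"
  where "Q_bar N \<epsilon> =
    {x \<in> {1..N} \<rightarrow>\<^sub>E UNIV. \<exists>y :: nat \<Rightarrow> nat \<Rightarrow> real.
       (\<forall>i\<in>{1..N - 1}. y 0 i = x i) \<and>
       (\<forall>i\<in>{N..2 ^ K_of N}. y 0 i = 0) \<and>
       y (K_of N) 1 = x N \<and>
       (\<forall>d\<in>Q_bar_description N \<epsilon>. satisfies y d)}"

definition largest_coeff :: "P_copy set \<Rightarrow> real"
  where "largest_coeff D = Max ((\<lambda>d. largest_coeff_P (copy_delta d)) ` D)"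

lemma largest_coeff_Q_bar:
  assumes "N \<ge> 3"
  shows "largest_coeff (Q_bar_description N \<epsilon>) = largest_coeff_P (delta_of N \<epsilon>)"
proof -
  let ?I = "SIGMA k : {..<K_of N}. {1..2 ^ (K_of N - k - 1) :: nat}"
  have "log 2 (real N - 1) > 0"
    using assms by simp
  then have "K_of N > 0"
    by (simp add: K_of_def)
  then have "(0, 1) \<in> ?I"
    by simp
  then have "(\<lambda>d. largest_coeff_P (copy_delta d)) ` Q_bar_description N \<epsilon>
      = {largest_coeff_P (delta_of N \<epsilon>)}"
    unfolding Q_bar_description_def image_image by (force simp: case_prod_beta)
  then show ?thesis
    by (simp add: largest_coeff_def)
qed

end

theory Submission
  imports Defs "HOL-Analysis.Convex"
begin

text \<open>With \<open>s = sqrt (1 + 2 / \<delta>)\<close>, dropping the ceiling in \<open>nu_hat \<delta>\<close> costs less than a factor 2, so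
  \<open>h < s - 1\<close> and the largest coefficient is below \<open>2 s\<^sup>2 - 6 s + 5 = 4 / \<delta> + 7 - 6 s\<close>.  Since
  \<open>\<delta> < 1/4\<close> means \<open>s > 3\<close>, this is below \<open>4 / \<delta>\<close>.  Finally \<open>\<delta> \<ge> ln (1 + \<epsilon>) / K \<ge> \<epsilon> ln 2 / K\<close>,
  the last step by concavity of the logarithm on \<open>[1, 2]\<close>.\<close>

lemma ln_add_one_ge_mult_ln2:
  fixes x :: real
  assumes "0 \<le> x" "x \<le> 1"
  shows "x * ln 2 \<le> ln (1 + x)"
proof -
  have "(1 - x) * ln 1 + x * ln 2 \<le> ln ((1 - x) * 1 + x * 2 :: real)"
    using concave_onD[OF ln_concave, of x 1 2] assms by simp
  then show ?thesis
    by (simp add: algebra_simps)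
qed

text \<open>A ceiling exceeds its argument by less than 1. For \<open>x\<close> below 1 the exponent
  may be negative, hence \<open>powi\<close>.\<close>

lemma powi_ceiling_log2_less:
  fixes x :: real
  assumes "0 < x"
  shows "2 powi \<lceil>log 2 x\<rceil> < 2 * x"
proof -
  have "2 powi \<lceil>log 2 x\<rceil> = (2 :: real) powr \<lceil>log 2 x\<rceil>"
    by (simp add: powr_real_of_int')
  also have "\<dots> < 2 powr (log 2 x + 1)"
    by (intro powr_less_mono) linarith+
  also have "\<dots> = 2 * x"
    using assms by (simp add: powr_add)
  finally show ?thesis .
qed

lemma largest_coeff_P_less:
  assumes "0 < \<delta>" "\<delta> < 1 / 4"
  shows "largest_coeff_P \<delta> < 4 / \<delta>"
proof -
  define s where "s = sqrt (1 + 2 / \<delta>)"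
  define h :: real where "h = 2 powi (nu_hat \<delta> - 2) + 2"
  have "8 < 2 / \<delta>"
    using assms by (simp add: field_simps)
  then have "s\<^sup>2 = 1 + 2 / \<delta>" "sqrt (3\<^sup>2) < s"
    unfolding s_def by (simp, intro real_sqrt_less_mono, simp)
  then have s: "s\<^sup>2 = 1 + 2 / \<delta>" "3 < s"
    by simp_all
  have "2 powi nu_hat \<delta> < 2 * (- 6 + 2 * s)"
    unfolding nu_hat_def s_def[symmetric] using s by (intro powi_ceiling_log2_less) simp
  \<comment> \<open>The shift by 2 in the exponent divides by 4, leaving
    \<open>s - 3\<close>.\<close>
  then have "h < s - 1"
    by (simp add: h_def power_int_diff)
  moreover have "2 < h"
    by (simp add: h_def)
  \<comment> \<open>Both factors are positive, so the bound on \<open>h\<close> applies to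
    each.\<close>
  ultimately have "h * (h - 1) < (s - 1) * (s - 2)"
    by (intro mult_strict_mono) simp_all
  then have "2 * h\<^sup>2 - 2 * h + 1 < 2 * s\<^sup>2 - 6 * s + 5"
    by (simp add: power2_eq_square algebra_simps)
  also have "\<dots> < 4 / \<delta>"
    using s by simp
  finally show ?thesis
    by (simp add: largest_coeff_P_def h_def)
qed

lemma delta_of_ge:
  assumes "0 \<le> \<epsilon>" "\<epsilon> \<le> 1"
  shows "ln 2 * \<epsilon> / K_of N \<le> delta_of N \<epsilon>"
proof -
  have "ln 2 * \<epsilon> / K_of N \<le> ln (1 + \<epsilon>) / K_of N"
    using ln_add_one_ge_mult_ln2[OF assms] by (intro divide_right_mono) (simp_all add: mult.commute)
  \<comment> \<open>With \<open>t = ln (1 + \<epsilon>) / K_of N\<close>, the right side is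
    \<open>exp t - 1\<close>, which is at least \<open>t\<close>. If \<open>K_of N = 0\<close>, both
    are 0.\<close>
  also have "\<dots> \<le> delta_of N \<epsilon>"
    using exp_ge_add_one_self[of "ln (1 + \<epsilon>) / K_of N"] assms
    by (simp add: delta_of_def powr_def del: exp_ge_add_one_self)
  finally show ?thesis .
qed

theorem proposition5:
  fixes N :: nat and \<epsilon> :: real
  assumes "N \<ge> 3"
    and "0 < \<epsilon>" and "\<epsilon> < 1"
    and "delta_of N \<epsilon> < 1 / 4"
  shows "largest_coeff (Q_bar_description N \<epsilon>) \<le> 4 * \<lceil>log 2 (real N - 1)\<rceil> / (ln 2 * \<epsilon>)"
proof -
  have "log 2 (real N - 1) > 0"
    using assms by simp
  then have K: "0 < K_of N" "real (K_of N) = \<lceil>log 2 (real N - 1)\<rceil>"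
    by (simp_all add: K_of_def)
  have lower: "ln 2 * \<epsilon> / K_of N \<le> delta_of N \<epsilon>"
    using assms by (intro delta_of_ge) simp_all
  \<comment> \<open>Gives \<open>delta_of N \<epsilon>\<close> its positivity and allows inverting
    the lower bound.\<close>
  moreover have pos: "0 < ln 2 * \<epsilon> / K_of N"
    using assms K by simp
  ultimately have "largest_coeff_P (delta_of N \<epsilon>) < 4 / delta_of N \<epsilon>"
    using assms by (intro largest_coeff_P_less) simp_all
  also have "\<dots> \<le> 4 / (ln 2 * \<epsilon> / K_of N)"
    using lower pos by (intro divide_left_mono mult_pos_pos) linarith+
  finally show ?thesis
    using assms K by (simp add: largest_coeff_Q_bar)
qed

end
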